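(* Consider a network of $n$ agents with $m=\mathrm{card}(\Theta)$ states, and let $M=\max_{k\in[n]}\mathrm{card}(\mathcal{S}_k)$ and $A=\max_{k\in[n]}\mathrm{card}(\mathcal{A}_k)$ denote the maximum cardinality of the signal and action spaces. There exists an algorithm with running time $O(Amn^2M^2)$ which, given the private signal of agent $i$ and the previous actions of her neighbors $\{\mathbf{a}_{j,\tau}:j\in\mathcal{N}_i,\ \tau<t\}$ in any transitive network, outputs $\mathbf{a}_{i,t}$, the Bayesian action of agent $i$ at time $t$.
   Context: Model. Agents $[n]$ interact over a fixed directed graph $\mathcal{G}$; $\mathcal{N}_i$ is the set of agents observed by $i$ and $i\in\mathcal{N}_i$. The state $\theta$ lies in a finite set $\Theta$ and has common prior $\nu$. Agent $i$ receives a private signal $\mathbf{s}_i$ in a finite set $\mathcal{S}_i$ with conditional distribution $\mathbb{P}_{i,\theta}$; signals are independent across agents conditioned on $\theta$. Agent $i$ has a finite action space $\mathcal{A}_i$ and utility $u_i:\mathcal{A}_i\times\Theta\to\mathbb{R}$. At each time $t=0,1,2,\ldots$ she takes the Bayesian action $\mathbf{a}_{i,t}\in\arg\max_{a\in\mathcal{A}_i}\mathbb{E}[u_i(a,\theta)\mid\mathbf{h}_{i,t}]$, with $\mathbf{h}_{i,t}=\{\mathbf{s}_i\}\cup\{\mathbf{a}_{j,\tau}:j\in\mathcal{N}_i,\tau<t\}$ and ties broken by choosing the lowest-ranked action in a fixed order on $\mathcal{A}_i$. The graph, prior, signal structures, action spaces, utilities and tie-breaking rule are common knowledge. A network is transitive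 if the directed neighborhood relation is reflexive and transitive: $i\in\mathcal{N}_i$ for all $i$, and $j\in\mathcal{N}_i$, $k\in\mathcal{N}_j$ imply $k\in\mathcal{N}_i$. Running time is measured by the number of additions and multiplications performed at a time step; the algorithm proceeds iteratively over time and at each step may use what it stored at earlier steps (for each neighbor $j$, the set of private signals of $j$ consistent with the actions observed so far). *)

theory Defs
  imports "HOL-Probability.Probability"
begin

text \<open>
  Agents, states, signals and actions are labelled by initial segments of the natural numbers:
  the agents are \<open>{..<agents G}\<close>, the state space is \<open>{..<states G}\<close>, agent \<open>i\<close> has signal
  space \<open>{..<signals G i}\<close> and action space \<open>{..<actions G i}\<close>.  The label of an action is its
  rank in the order used for breaking ties.  \<open>signal_law G i \<theta>\<close> is the law of the private signal
  of agent \<open>i\<close> in state \<open>\<theta>\<close>.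
\<close>

record game =
  agents :: nat
  nbrs :: "nat \<Rightarrow> nat set"
  states :: nat
  prior :: "nat pmf"
  signals :: "nat \<Rightarrow> nat"
  signal_law :: "nat \<Rightarrow> nat \<Rightarrow> nat pmf"
  actions :: "nat \<Rightarrow> nat"
  utility :: "nat \<Rightarrow> nat \<Rightarrow> nat \<Rightarrow> real"

definition wf_game :: "game \<Rightarrow> bool" where
  "wf_game G \<longleftrightarrow>
     set_pmf (prior G) \<subseteq> {..<states G} \<and>
     (\<forall>i<agents G. nbrs G i \<subseteq> {..<agents G} \<and> i \<in> nbrs G i \<and> 0 < actions G i \<and>
        (\<forall>\<theta><states G. set_pmf (signal_law G i \<theta>) \<subseteq> {..<signals G i}))"

definition transitive_network :: "game \<Rightarrow> bool" where
  "transitive_network G \<longleftrightarrow>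
     (\<forall>i<agents G. i \<in> nbrs G i) \<and>
     (\<forall>i<agents G. \<forall>j\<in>nbrs G i. \<forall>k\<in>nbrs G j. k \<in> nbrs G i)"

text \<open>Joint law of the state and the signal profile: signals are independent given the state.\<close>

definition joint :: "game \<Rightarrow> (nat \<times> (nat \<Rightarrow> nat)) pmf" where
  "joint G = bind_pmf (prior G) (\<lambda>\<theta>.
     map_pmf (Pair \<theta>) (Pi_pmf {..<agents G} 0 (\<lambda>i. signal_law G i \<theta>)))"

text \<open>
  Expected utility of action \<open>a\<close> given that the signal profile lies in \<open>H\<close>.
  It is only meaningful if \<open>H\<close> has positive probability.
\<close>

definition expected_utility :: "game \<Rightarrow> nat \<Rightarrow> (nat \<Rightarrow> nat) set \<Rightarrow> nat \<Rightarrow> real" where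
  "expected_utility G i H a =
     measure_pmf.expectation (cond_pmf (joint G) {\<omega>. snd \<omega> \<in> H}) (\<lambda>\<omega>. utility G i a (fst \<omega>))"

definition optimal_action :: "game \<Rightarrow> nat \<Rightarrow> (nat \<Rightarrow> nat) set \<Rightarrow> nat" where
  "optimal_action G i H =
     (LEAST a. is_arg_max (expected_utility G i H) (\<lambda>b. b < actions G i) a)"

text \<open>
  \<open>bayes_action G t i s\<close> is the action of agent \<open>i\<close> at time \<open>t\<close> when the signal profile is \<open>s\<close>.
  She conditions on the set of all signal profiles that give her the same history as \<open>s\<close>, i.e.
  the same private signal and the same actions of her neighbours at all times \<open>\<tau> < t\<close>.
\<close>

function bayes_action :: "game \<Rightarrow> nat \<Rightarrow> nat \<Rightarrow> (nat \<Rightarrow> nat) \<Rightarrow> nat" where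
  "bayes_action G t i s = optimal_action G i
     {s'. s' i = s i \<and>
          (\<forall>\<tau>\<in>{..<t}. \<forall>j\<in>nbrs G i. bayes_action G \<tau> j s' = bayes_action G \<tau> j s)}"
  by pat_completeness auto
termination
  by (relation "Wellfounded.measure (\<lambda>(G, t, i, s). t)") auto

declare bayes_action.simps [simp del]

text \<open>
  An algorithm is a program of a small imperative language over multi-dimensional arrays of
  natural numbers and of real numbers; a scalar variable is an array accessed with the index
  list \<open>[]\<close>.  The only constants are natural numbers and integers; arbitrary real constants
  would allow a program to contain an infinite amount of information.
\<close>

record store =
  nats :: "string \<Rightarrow> nat list \<Rightarrow> nat"
  reals :: "string \<Rightarrow> nat list \<Rightarrow> real"

datatype nexp =
    NConst nat
  | NGet string "nexp list"
  | NAdd nexp nexp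
  | NMul nexp nexp

datatype rexp =
    RConst int
  | RGet string "nexp list"
  | RAdd rexp rexp
  | RMul rexp rexp

datatype bexp =
    NLess nexp nexp
  | RLess rexp rexp
  | BNot bexp
  | BAnd bexp bexp

datatype com =
    Skip
  | NSet string "nexp list" nexp
  | RSet string "nexp list" rexp
  | Seq com com
  | If bexp com com
  | For string nexp com

primrec nval :: "store \<Rightarrow> nexp \<Rightarrow> nat" where
  "nval \<sigma> (NConst k) = k"
| "nval \<sigma> (NGet x es) = nats \<sigma> x (map (nval \<sigma>) es)"
| "nval \<sigma> (NAdd e f) = nval \<sigma> e + nval \<sigma> f"
| "nval \<sigma> (NMul e f) = nval \<sigma> e * nval \<sigma> f"

primrec rval :: "store \<Rightarrow> rexp \<Rightarrow> real" where
  "rval \<sigma> (RConst k) = of_int k"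
| "rval \<sigma> (RGet x es) = reals \<sigma> x (map (nval \<sigma>) es)"
| "rval \<sigma> (RAdd e f) = rval \<sigma> e + rval \<sigma> f"
| "rval \<sigma> (RMul e f) = rval \<sigma> e * rval \<sigma> f"

primrec bval :: "store \<Rightarrow> bexp \<Rightarrow> bool" where
  "bval \<sigma> (NLess e f) \<longleftrightarrow> nval \<sigma> e < nval \<sigma> f"
| "bval \<sigma> (RLess e f) \<longleftrightarrow> rval \<sigma> e < rval \<sigma> f"
| "bval \<sigma> (BNot b) \<longleftrightarrow> \<not> bval \<sigma> b"
| "bval \<sigma> (BAnd b c) \<longleftrightarrow> bval \<sigma> b \<and> bval \<sigma> c"

text \<open>
  The numbers of additions and multiplications in an expression, those in array indices included.
\<close>

primrec nops :: "nexp \<Rightarrow> nat" where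
  "nops (NConst k) = 0"
| "nops (NGet x es) = sum_list (map nops es)"
| "nops (NAdd e f) = nops e + nops f + 1"
| "nops (NMul e f) = nops e + nops f + 1"

primrec rops :: "rexp \<Rightarrow> nat" where
  "rops (RConst k) = 0"
| "rops (RGet x es) = sum_list (map nops es)"
| "rops (RAdd e f) = rops e + rops f + 1"
| "rops (RMul e f) = rops e + rops f + 1"

primrec bops :: "bexp \<Rightarrow> nat" where
  "bops (NLess e f) = nops e + nops f"
| "bops (RLess e f) = rops e + rops f"
| "bops (BNot b) = bops b"
| "bops (BAnd b c) = bops b + bops c"

definition nset :: "string \<Rightarrow> nat list \<Rightarrow> nat \<Rightarrow> store \<Rightarrow> store" where
  "nset x is v \<sigma> = \<sigma>\<lparr>nats := (nats \<sigma>)(x := (nats \<sigma> x)(is := v))\<rparr>"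

definition rset :: "string \<Rightarrow> nat list \<Rightarrow> real \<Rightarrow> store \<Rightarrow> store" where
  "rset x is v \<sigma> = \<sigma>\<lparr>reals := (reals \<sigma>)(x := (reals \<sigma> x)(is := v))\<rparr>"

text \<open>
  \<open>exec c \<sigma>\<close> is the final store together with the number of additions and multiplications.
  \<open>For x e c\<close> runs \<open>c\<close> with \<open>x = 0, 1, \<dots>, k - 1\<close>, where \<open>k\<close> is the value of \<open>e\<close> on entry; every
  iteration is charged one addition for incrementing the counter.  As \<open>For\<close> is the only loop,
  the number of all steps (comparisons and assignments included) is thus at most a constant,
  depending on the program, times one plus the number of additions and multiplications.
\<close>

primrec exec :: "com \<Rightarrow> store \<Rightarrow> store \<times> nat" where
  "exec Skip \<sigma> = (\<sigma>, 0)"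
| "exec (NSet x es e) \<sigma> =
     (nset x (map (nval \<sigma>) es) (nval \<sigma> e) \<sigma>, sum_list (map nops es) + nops e)"
| "exec (RSet x es e) \<sigma> =
     (rset x (map (nval \<sigma>) es) (rval \<sigma> e) \<sigma>, sum_list (map nops es) + rops e)"
| "exec (Seq c d) \<sigma> =
     (let (\<sigma>1, k1) = exec c \<sigma>; (\<sigma>2, k2) = exec d \<sigma>1 in (\<sigma>2, k1 + k2))"
| "exec (If b c d) \<sigma> =
     (let (\<sigma>1, k1) = (if bval \<sigma> b then exec c \<sigma> else exec d \<sigma>) in (\<sigma>1, bops b + k1))"
| "exec (For x e c) \<sigma> =
     foldl (\<lambda>(\<sigma>1, k1) v. let (\<sigma>2, k2) = exec c (nset x [] v \<sigma>1) in (\<sigma>2, k1 + k2 + 1))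
       (\<sigma>, nops e) [0..<nval \<sigma> e]"

text \<open>
  The initial memory of the algorithm of agent \<open>i\<close> holds the common knowledge, the name of the
  agent and her private signal \<open>x\<close>; everything else is zero.
\<close>

definition init_store :: "game \<Rightarrow> nat \<Rightarrow> nat \<Rightarrow> store" where
  "init_store G i x = \<lparr>
     nats = (\<lambda>_ _. 0)(
       ''agents'' := (\<lambda>_. 0)([] := agents G),
       ''states'' := (\<lambda>_. 0)([] := states G),
       ''self'' := (\<lambda>_. 0)([] := i),
       ''signal'' := (\<lambda>_. 0)([] := x),
       ''signals'' := (\<lambda>is. case is of [k] \<Rightarrow> signals G k | _ \<Rightarrow> 0),
       ''actions'' := (\<lambda>is. case is of [k] \<Rightarrow> actions G k | _ \<Rightarrow> 0),
       ''nbrs'' := (\<lambda>is. case is of [j, k] \<Rightarrow> of_bool (k \<in> nbrs G j) | _ \<Rightarrow> 0)),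
     reals = (\<lambda>_ _. 0)(
       ''prior'' := (\<lambda>is. case is of [\<theta>] \<Rightarrow> pmf (prior G) \<theta> | _ \<Rightarrow> 0),
       ''law'' := (\<lambda>is. case is of [k, \<theta>, y] \<Rightarrow> pmf (signal_law G k \<theta>) y | _ \<Rightarrow> 0),
       ''utility'' := (\<lambda>is. case is of [k, a, \<theta>] \<Rightarrow> utility G k a \<theta> | _ \<Rightarrow> 0))\<rparr>"

text \<open>Agent \<open>i\<close> is shown the actions \<open>act j\<close> of her neighbours \<open>j\<close>, and of nobody else.\<close>

definition observe :: "game \<Rightarrow> nat \<Rightarrow> (nat \<Rightarrow> nat) \<Rightarrow> store \<Rightarrow> store" where
  "observe G i act \<sigma> = \<sigma>\<lparr>nats := (nats \<sigma>)(''observed'' :=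
     (\<lambda>is. case is of [j] \<Rightarrow> if j \<in> nbrs G i then act j else 0 | _ \<Rightarrow> 0))\<rparr>"

text \<open>
  The program is executed once at every time \<open>t\<close>.  It starts from the memory left by its previous
  execution, into which the actions \<open>act (t - 1)\<close> observed last have been entered; nothing has
  been observed at time \<open>0\<close>.
\<close>

primrec store_at :: "com \<Rightarrow> game \<Rightarrow> nat \<Rightarrow> nat \<Rightarrow> (nat \<Rightarrow> nat \<Rightarrow> nat) \<Rightarrow> nat \<Rightarrow> store" where
  "store_at c G i x act 0 = init_store G i x"
| "store_at c G i x act (Suc t) = observe G i (act t) (fst (exec c (store_at c G i x act t)))"

definition output_at :: "com \<Rightarrow> game \<Rightarrow> nat \<Rightarrow> nat \<Rightarrow> (nat \<Rightarrow> nat \<Rightarrow> nat) \<Rightarrow> nat \<Rightarrow> nat" where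
  "output_at c G i x act t = nats (fst (exec c (store_at c G i x act t))) ''output'' []"

definition time_at :: "com \<Rightarrow> game \<Rightarrow> nat \<Rightarrow> nat \<Rightarrow> (nat \<Rightarrow> nat \<Rightarrow> nat) \<Rightarrow> nat \<Rightarrow> nat" where
  "time_at c G i x act t = snd (exec c (store_at c G i x act t))"

definition max_signals :: "game \<Rightarrow> nat" where
  "max_signals G = Max (signals G ` {..<agents G})"

definition max_actions :: "game \<Rightarrow> nat" where
  "max_actions G = Max (actions G ` {..<agents G})"

end

theory Submission
  imports Defs
begin

text \<open>
  In a transitive network agent \<open>i\<close> sees everything that a neighbour \<open>j\<close> sees, except the private
  signal of \<open>j\<close>.  Hence \<open>i\<close> can compute, for every signal \<open>y\<close>, what \<open>j\<close> would do at time \<open>t\<close>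
  if her signal were \<open>y\<close>, and exclude \<open>y\<close> as soon as this differs from what \<open>j\<close> actually did.
  The history of \<open>j\<close> is then equivalent to the event that her own signal is \<open>y\<close> and that no
  neighbour has an excluded signal.  Since signals are independent given the state, the posterior
  weight of a state \<open>\<theta>\<close> is the prior times the law of \<open>y\<close> times, for each other neighbour, the mass
  of her non-excluded signals.  Signals \<open>y\<close> of posterior weight zero get meaningless predictions,
  which is harmless because no signal profile of positive probability is affected.
\<close>

section \<open>Reasoning about programs\<close>

primrec nwrites :: "com \<Rightarrow> string set" where
  "nwrites Skip = {}"
| "nwrites (NSet x es e) = {x}"
| "nwrites (RSet x es e) = {}"
| "nwrites (Seq c d) = nwrites c \<union> nwrites d"
| "nwrites (If b c d) = nwrites c \<union> nwrites d"
| "nwrites (For x e c) = insert x (nwrites c)"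

primrec rwrites :: "com \<Rightarrow> string set" where
  "rwrites Skip = {}"
| "rwrites (NSet x es e) = {}"
| "rwrites (RSet x es e) = {x}"
| "rwrites (Seq c d) = rwrites c \<union> rwrites d"
| "rwrites (If b c d) = rwrites c \<union> rwrites d"
| "rwrites (For x e c) = rwrites c"

text \<open>Changes are tracked by array name, whatever the index. Later arguments that a loop
  leaves the inputs, the outer counters or the exclusion marks alone are instances of this
  relation.\<close>

definition frame :: "com \<Rightarrow> store \<Rightarrow> store \<Rightarrow> bool" where
  "frame c \<sigma> \<tau> \<longleftrightarrow>
     (\<forall>x. x \<notin> nwrites c \<longrightarrow> nats \<tau> x = nats \<sigma> x) \<and> (\<forall>x. x \<notin> rwrites c \<longrightarrow> reals \<tau> x = reals \<sigma> x)"

lemma frame_nats: "frame c \<sigma> \<tau> \<Longrightarrow> x \<notin> nwrites c \<Longrightarrow> nats \<tau> x = nats \<sigma> x"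
  by (simp add: frame_def)

lemma nats_nset [simp]: "nats (nset x is v \<sigma>) = (nats \<sigma>)(x := (nats \<sigma> x)(is := v))"
  and reals_nset [simp]: "reals (nset x is v \<sigma>) = reals \<sigma>"
  and nats_rset [simp]: "nats (rset x is r \<sigma>) = nats \<sigma>"
  and reals_rset [simp]: "reals (rset x is r \<sigma>) = (reals \<sigma>)(x := (reals \<sigma> x)(is := r))"
  by (simp_all add: nset_def rset_def)

lemma fst_exec_Seq [simp]: "fst (exec (Seq c d) \<sigma>) = fst (exec d (fst (exec c \<sigma>)))"
  and snd_exec_Seq [simp]:
    "snd (exec (Seq c d) \<sigma>) = snd (exec c \<sigma>) + snd (exec d (fst (exec c \<sigma>)))"
  by (simp_all add: split_beta Let_def)

lemma fst_exec_If [simp]: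
    "fst (exec (If b c d) \<sigma>) = (if bval \<sigma> b then fst (exec c \<sigma>) else fst (exec d \<sigma>))"
  and snd_exec_If [simp]:
    "snd (exec (If b c d) \<sigma>) = bops b + (if bval \<sigma> b then snd (exec c \<sigma>) else snd (exec d \<sigma>))"
  by (simp_all add: split_beta Let_def)

declare exec.simps(4-6) [simp del]

lemma frame_exec: "frame c \<sigma> (fst (exec c \<sigma>))"
proof (induction c arbitrary: \<sigma>)
  case (Seq c d)
  show ?case using Seq[of \<sigma>] Seq(2)[of "fst (exec c \<sigma>)"] by (auto simp: frame_def)
next
  case (If b c d)
  show ?case using If[of \<sigma>] by (auto simp: frame_def)
next
  case (For x e c)
  \<comment> \<open>\<open>r n\<close> is the result of the first \<open>n\<close> iterations, so
    that induction on \<open>n\<close> peels off the last one.\<close>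
  define r where "r n = foldl (\<lambda>(\<sigma>1, k1) v.
          let (\<sigma>2, k2) = exec c (nset x [] v \<sigma>1) in (\<sigma>2, k1 + k2 + 1)) (\<sigma>, nops e) [0..<n]" for n
  have "frame (For x e c) \<sigma> (fst (r n))" for n
  proof (induction n)
    case 0
    show ?case by (simp add: frame_def r_def)
  next
    case (Suc n)
    have "fst (r (Suc n)) = fst (exec c (nset x [] n (fst (r n))))"
      by (simp add: r_def split_beta Let_def)
    then show ?case using Suc For[of "nset x [] n (fst (r n))"] by (auto simp: frame_def)
  qed
  then show ?case by (simp add: exec.simps r_def)
qed (auto simp: frame_def)

text \<open>Loop rule: \<open>P v\<close> is the invariant on reaching iteration \<open>v\<close>,
  \<open>B\<close> bounds the cost of one body, and \<open>Suc B\<close> adds the counter increment.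
  The \<open>frame\<close> premise is available at every intermediate store, so an invariant need
  only describe what the loop itself writes.\<close>

lemma exec_For:
  assumes "P 0 \<sigma>"
    and "\<And>v \<tau>. v < nval \<sigma> e \<Longrightarrow> P v \<tau> \<Longrightarrow> frame (For x e c) \<sigma> \<tau> \<Longrightarrow>
      P (Suc v) (fst (exec c (nset x [] v \<tau>))) \<and> snd (exec c (nset x [] v \<tau>)) \<le> B"
  shows "P (nval \<sigma> e) (fst (exec (For x e c) \<sigma>)) \<and>
    snd (exec (For x e c) \<sigma>) \<le> nops e + nval \<sigma> e * Suc B"
proof -
  define r where "r n = foldl (\<lambda>(\<sigma>1, k1) v.
          let (\<sigma>2, k2) = exec c (nset x [] v \<sigma>1) in (\<sigma>2, k1 + k2 + 1)) (\<sigma>, nops e) [0..<n]" for n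
  have "P n (fst (r n)) \<and> frame (For x e c) \<sigma> (fst (r n)) \<and> snd (r n) \<le> nops e + n * Suc B"
    if "n \<le> nval \<sigma> e" for n
    using that
  proof (induction n)
    case 0
    then show ?case using assms(1) by (simp add: frame_def r_def)
  next
    case (Suc n)
    then have IH: "P n (fst (r n))" "frame (For x e c) \<sigma> (fst (r n))"
        "snd (r n) \<le> nops e + n * Suc B"
      by auto
    have r: "fst (r (Suc n)) = fst (exec c (nset x [] n (fst (r n))))"
      "snd (r (Suc n)) = snd (r n) + snd (exec c (nset x [] n (fst (r n)))) + 1"
      by (simp_all add: r_def split_beta Let_def)
    have s: "P (Suc n) (fst (r (Suc n))) \<and> snd (exec c (nset x [] n (fst (r n)))) \<le> B"
      using assms(2)[of n "fst (r n)"] IH Suc.prems by (simp add: r)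
    have "frame (For x e c) \<sigma> (fst (r (Suc n)))"
      using IH(2) frame_exec[of c "nset x [] n (fst (r n))"] by (auto simp: frame_def r)
    then show ?case using s IH(3) by (simp add: r)
  qed
  from this[of "nval \<sigma> e"] show ?thesis by (simp add: exec.simps r_def)
qed

section \<open>The program\<close>

abbreviation nv :: "string \<Rightarrow> nexp" where
  "nv x \<equiv> NGet x []"

definition consistent_mass_com :: com where
  "consistent_mass_com = Seq (RSet ''mass'' [] (RConst 0))
     (For ''z'' (NGet ''signals'' [nv ''k''])
       (If (NLess (NGet ''excluded'' [nv ''k'', nv ''z'']) (NConst 1))
         (RSet ''mass'' [] (RAdd (RGet ''mass'' []) (RGet ''law'' [nv ''k'', nv ''th'', nv ''z''])))
         Skip))"

text \<open>The language compares naturals only by \<open><\<close>, so \<open>k = j\<close> is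
  expressed as neither being less than the other. Agent \<open>j\<close> is left out of the product
  because her own signal is fixed to \<open>y\<close>, which the initial factor accounts
  for.\<close>

definition weight_com :: com where
  "weight_com = Seq
     (RSet ''weight'' [nv ''th'']
       (RMul (RGet ''prior'' [nv ''th'']) (RGet ''law'' [nv ''j'', nv ''th'', nv ''y''])))
     (For ''k'' (nv ''agents'')
       (If (BAnd (NLess (NConst 0) (NGet ''nbrs'' [nv ''j'', nv ''k'']))
              (BNot (BAnd (BNot (NLess (nv ''j'') (nv ''k''))) (BNot (NLess (nv ''k'') (nv ''j''))))))
         (Seq consistent_mass_com
           (RSet ''weight'' [nv ''th''] (RMul (RGet ''weight'' [nv ''th'']) (RGet ''mass'' []))))
         Skip))"

definition weights_com :: com where
  "weights_com = For ''th'' (nv ''states'') weight_com"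

definition value_com :: com where
  "value_com = Seq (RSet ''value'' [nv ''a''] (RConst 0))
     (For ''th'' (nv ''states'')
       (RSet ''value'' [nv ''a''] (RAdd (RGet ''value'' [nv ''a''])
         (RMul (RGet ''weight'' [nv ''th'']) (RGet ''utility'' [nv ''j'', nv ''a'', nv ''th''])))))"

definition values_com :: com where
  "values_com = For ''a'' (NGet ''actions'' [nv ''j'']) value_com"

text \<open>Only a strict improvement replaces the current candidate, so ties go to the action of
  smallest label.\<close>

definition argmax_com :: com where
  "argmax_com = Seq (NSet ''predicted'' [nv ''j'', nv ''y''] (NConst 0))
     (For ''a'' (NGet ''actions'' [nv ''j''])
       (If (RLess (RGet ''value'' [NGet ''predicted'' [nv ''j'', nv ''y'']]) (RGet ''value'' [nv ''a'']))
         (NSet ''predicted'' [nv ''j'', nv ''y''] (nv ''a''))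
         Skip))"

definition predict_com :: com where
  "predict_com = For ''j'' (nv ''agents'') (For ''y'' (NGet ''signals'' [nv ''j''])
     (Seq weights_com (Seq values_com argmax_com)))"

text \<open>
  At time \<open>0\<close> nothing may be excluded; this works because the predictions and the observations
  are both still zero in the initial memory.
\<close>

definition exclude_com :: com where
  "exclude_com = For ''j'' (nv ''agents'') (For ''y'' (NGet ''signals'' [nv ''j''])
     (If (BAnd (BNot (NLess (NGet ''predicted'' [nv ''j'', nv ''y'']) (NGet ''observed'' [nv ''j''])))
               (BNot (NLess (NGet ''observed'' [nv ''j'']) (NGet ''predicted'' [nv ''j'', nv ''y'']))))
       Skip
       (NSet ''excluded'' [nv ''j'', nv ''y''] (NConst 1))))"

text \<open>Exclusion comes first: at that moment \<open>predicted\<close> still holds the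
  predictions of the previous execution, and \<open>observed\<close> holds the actions taken at that
  same time.\<close>

definition bayes_com :: com where
  "bayes_com = Seq exclude_com (Seq predict_com
     (NSet ''output'' [] (NGet ''predicted'' [nv ''self'', nv ''signal''])))"

lemma writes [simp]:
  "nwrites consistent_mass_com = {''z''}" "rwrites consistent_mass_com = {''mass''}"
  "nwrites weight_com = {''k'', ''z''}" "rwrites weight_com = {''weight'', ''mass''}"
  "nwrites weights_com = {''th'', ''k'', ''z''}" "rwrites weights_com = {''weight'', ''mass''}"
  "nwrites value_com = {''th''}" "rwrites value_com = {''value''}"
  "nwrites values_com = {''a'', ''th''}" "rwrites values_com = {''value''}"
  "nwrites argmax_com = {''predicted'', ''a''}" "rwrites argmax_com = {}"
  "nwrites predict_com = {''j'', ''y'', ''th'', ''k'', ''z'', ''a'', ''predicted''}"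
  "rwrites predict_com = {''weight'', ''mass'', ''value''}"
  "nwrites exclude_com = {''j'', ''y'', ''excluded''}" "rwrites exclude_com = {}"
  by (auto simp: consistent_mass_com_def weight_com_def weights_com_def value_com_def
      values_com_def argmax_com_def predict_com_def exclude_com_def)

section \<open>Correctness and cost of the subroutines\<close>

definition inputs :: "game \<Rightarrow> nat \<Rightarrow> nat \<Rightarrow> store \<Rightarrow> bool" where
  "inputs G i x \<sigma> \<longleftrightarrow>
     (\<forall>v\<in>{''agents'', ''states'', ''self'', ''signal'', ''signals'', ''actions'', ''nbrs''}.
        nats \<sigma> v = nats (init_store G i x) v) \<and>
     (\<forall>v\<in>{''prior'', ''law'', ''utility''}. reals \<sigma> v = reals (init_store G i x) v)"

lemma inputs_simps:
  assumes "inputs G i x \<sigma>"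
  shows "nats \<sigma> ''agents'' [] = agents G" "nats \<sigma> ''states'' [] = states G"
    "nats \<sigma> ''self'' [] = i" "nats \<sigma> ''signal'' [] = x"
    "nats \<sigma> ''signals'' [k] = signals G k" "nats \<sigma> ''actions'' [k] = actions G k"
    "nats \<sigma> ''nbrs'' [j, k] = of_bool (k \<in> nbrs G j)"
    "reals \<sigma> ''prior'' [\<theta>] = pmf (prior G) \<theta>"
    "reals \<sigma> ''law'' [k, \<theta>, y] = pmf (signal_law G k \<theta>) y"
    "reals \<sigma> ''utility'' [k, a, \<theta>] = utility G k a \<theta>"
  using assms by (simp_all add: inputs_def init_store_def)

lemma inputs_frame:
  assumes "frame c \<sigma> \<tau>" "inputs G i x \<sigma>"
    "nwrites c \<inter> {''agents'', ''states'', ''self'', ''signal'', ''signals'', ''actions'', ''nbrs''} = {}"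
    "rwrites c \<inter> {''prior'', ''law'', ''utility''} = {}"
  shows "inputs G i x \<tau>"
  using assms unfolding inputs_def frame_def by (metis disjoint_iff)

lemma signals_le: "k < agents G \<Longrightarrow> signals G k \<le> max_signals G"
  and actions_le: "k < agents G \<Longrightarrow> actions G k \<le> max_actions G"
  by (simp_all add: max_signals_def max_actions_def)

text \<open>In a well-formed game, the probability in state \<theta> that the signal of
  \<open>k\<close> satisfies \<open>F k\<close>.\<close>

definition consistent_mass :: "game \<Rightarrow> (nat \<Rightarrow> nat \<Rightarrow> bool) \<Rightarrow> nat \<Rightarrow> nat \<Rightarrow> real" where
  "consistent_mass G F \<theta> k = (\<Sum>z<signals G k. if F k z then pmf (signal_law G k \<theta>) z else 0)"

text \<open>By conditional independence this is the joint probability of state \<theta>, signal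
  \<open>y\<close> for \<open>j\<close>, and signals satisfying \<open>F\<close> for her other
  neighbours: the posterior weight before normalisation.\<close>

definition weight :: "game \<Rightarrow> (nat \<Rightarrow> nat \<Rightarrow> bool) \<Rightarrow> nat \<Rightarrow> nat \<Rightarrow> nat \<Rightarrow> real" where
  "weight G F j y \<theta> = pmf (prior G) \<theta> * pmf (signal_law G j \<theta>) y *
     (\<Prod>k<agents G. if k \<in> nbrs G j \<and> k \<noteq> j then consistent_mass G F \<theta> k else 1)"

text \<open>Unnormalised weights suffice, since a positive common factor does not move the
  maximisers; this also avoids division, which the language does not offer.\<close>

definition predict :: "game \<Rightarrow> (nat \<Rightarrow> nat \<Rightarrow> bool) \<Rightarrow> nat \<Rightarrow> nat \<Rightarrow> nat" where
  "predict G F j y =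
     (LEAST a. is_arg_max (\<lambda>a. \<Sum>\<theta><states G. weight G F j y \<theta> * utility G j a \<theta>)
        (\<lambda>a. a < actions G j) a)"

text \<open>Zero stands for "not excluded", so that the initial memory excludes no signal.\<close>

definition consistent :: "store \<Rightarrow> nat \<Rightarrow> nat \<Rightarrow> bool" where
  "consistent \<sigma> k z \<longleftrightarrow> nats \<sigma> ''excluded'' [k, z] = 0"

lemma exec_consistent_mass_com:
  assumes "inputs G i x \<sigma>" "nats \<sigma> ''k'' [] = k" "nats \<sigma> ''th'' [] = \<theta>" "k < agents G"
  shows "reals (fst (exec consistent_mass_com \<sigma>)) ''mass'' [] = consistent_mass G (consistent \<sigma>) \<theta> k"
    (is "?value")
    and "snd (exec consistent_mass_com \<sigma>) \<le> 2 * max_signals G" (is "?cost")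
proof -
  let ?e = "NGet ''signals'' [nv ''k'']"
  let ?c = "If (NLess (NGet ''excluded'' [nv ''k'', nv ''z'']) (NConst 1))
         (RSet ''mass'' [] (RAdd (RGet ''mass'' []) (RGet ''law'' [nv ''k'', nv ''th'', nv ''z''])))
         Skip"
  let ?s = "rset ''mass'' [] 0 \<sigma>"
  let ?P = "\<lambda>v \<tau>. reals \<tau> ''mass'' [] =
    (\<Sum>z<v. if consistent \<sigma> k z then pmf (signal_law G k \<theta>) z else 0)"
  have inp: "inputs G i x ?s" using assms(1) by (simp add: inputs_def)
  \<comment> \<open>Each iteration performs at most one addition to \<open>mass\<close>; the counter
    is the second unit behind the factor 2.\<close>
  have "?P (nval ?s ?e) (fst (exec (For ''z'' ?e ?c) ?s)) \<and>
    snd (exec (For ''z'' ?e ?c) ?s) \<le> nops ?e + nval ?s ?e * Suc 1"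
  proof (rule exec_For, goal_cases)
    case 1
    then show ?case by simp
  next
    case (2 v \<tau>)
    have "inputs G i x \<tau>" using inputs_frame[OF 2(3) inp] by simp
    with 2 assms show ?case
      by (simp add: inputs_simps frame_def consistent_def)
  qed
  moreover have "nval ?s ?e = signals G k"
    using assms by (simp add: inputs_simps)
  ultimately show ?value ?cost
    using signals_le[OF assms(4)]
    by (simp_all add: consistent_mass_com_def consistent_mass_def)
qed

text \<open>The invariant is the partial product over \<open>k < v\<close>. The whole array is
  described, so that the loop over states can keep the weights found before.\<close>

lemma exec_weight_com:
  assumes "inputs G i x \<sigma>" "nats \<sigma> ''j'' [] = j" "nats \<sigma> ''y'' [] = y" "nats \<sigma> ''th'' [] = \<theta>"
    "0 < max_signals G"
  shows "reals (fst (exec weight_com \<sigma>)) ''weight'' =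
      (reals \<sigma> ''weight'')([\<theta>] := weight G (consistent \<sigma>) j y \<theta>)" (is "?value")
    and "snd (exec weight_com \<sigma>) \<le> 1 + 4 * (agents G * max_signals G)" (is "?cost")
proof -
  let ?F = "consistent \<sigma>"
  let ?e = "nv ''agents''"
  let ?c = "If (BAnd (NLess (NConst 0) (NGet ''nbrs'' [nv ''j'', nv ''k'']))
              (BNot (BAnd (BNot (NLess (nv ''j'') (nv ''k''))) (BNot (NLess (nv ''k'') (nv ''j''))))))
         (Seq consistent_mass_com
           (RSet ''weight'' [nv ''th''] (RMul (RGet ''weight'' [nv ''th'']) (RGet ''mass'' []))))
         Skip"
  let ?init = "RSet ''weight'' [nv ''th'']
       (RMul (RGet ''prior'' [nv ''th'']) (RGet ''law'' [nv ''j'', nv ''th'', nv ''y'']))"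
  let ?s = "fst (exec ?init \<sigma>)"
  let ?P = "\<lambda>v \<tau>. reals \<tau> ''weight'' = (reals \<sigma> ''weight'')([\<theta>] :=
    pmf (prior G) \<theta> * pmf (signal_law G j \<theta>) y *
    (\<Prod>k<v. if k \<in> nbrs G j \<and> k \<noteq> j then consistent_mass G ?F \<theta> k else 1))"
  have inp: "inputs G i x ?s" using assms(1) by (simp add: inputs_def)
  have "?P (nval ?s ?e) (fst (exec (For ''k'' ?e ?c) ?s)) \<and>
    snd (exec (For ''k'' ?e ?c) ?s) \<le> nops ?e + nval ?s ?e * Suc (2 * max_signals G + 1)"
  proof (rule exec_For, goal_cases)
    case 1
    then show ?case using assms by (simp add: inputs_simps)
  next
    case (2 v \<tau>)
    let ?t = "nset ''k'' [] v \<tau>"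
    let ?t' = "fst (exec consistent_mass_com ?t)"
    have "inputs G i x \<tau>" using inputs_frame[OF 2(3) inp] by simp
    then have it: "inputs G i x ?t" by (simp add: inputs_def)
    have v: "v < agents G" using 2(1) by (simp add: inputs_simps[OF assms(1)])
    have F: "consistent ?t = ?F" using 2(3) by (simp add: frame_def consistent_def fun_eq_iff)
    have vars: "nats \<tau> ''j'' [] = j" "nats \<tau> ''y'' [] = y" "nats \<tau> ''th'' [] = \<theta>"
      using 2(3) assms by (simp_all add: frame_def)
    have th: "nats ?t ''th'' [] = \<theta>" and k: "nats ?t ''k'' [] = v" using vars by simp_all
    have f: "nats ?t' ''th'' [] = \<theta>" "reals ?t' ''weight'' = reals \<tau> ''weight''"
      using frame_exec[of consistent_mass_com ?t] th by (simp_all add: frame_def)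
    show ?case
      using exec_consistent_mass_com[OF it k th v] 2(2) vars f
      by (auto simp: inputs_simps[OF it, simplified] F)
  qed
  moreover have "nval ?s ?e = agents G"
    using assms by (simp add: inputs_simps)
  ultimately have "?P (agents G) (fst (exec (For ''k'' ?e ?c) ?s))"
    and c: "snd (exec (For ''k'' ?e ?c) ?s) \<le> agents G * Suc (2 * max_signals G + 1)"
    by (simp_all only: nops.simps list.map sum_list.Nil add_0)
  then show ?value unfolding weight_com_def weight_def fst_exec_Seq by blast
  \<comment> \<open>With \<open>M = max_signals G\<close> at least 1, \<open>2 * M + 2\<close> is at
    most \<open>4 * M\<close>; absorbing constants keeps every bound a single monomial.\<close>
  have "agents G * Suc (2 * max_signals G + 1) \<le> agents G * (4 * max_signals G)"
    using assms(5) by (intro mult_le_mono2) auto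
  moreover have "snd (exec weight_com \<sigma>) = 1 + snd (exec (For ''k'' ?e ?c) ?s)"
    by (simp add: weight_com_def)
  ultimately show ?cost using c by linarith
qed

lemma exec_weights_com:
  assumes "inputs G i x \<sigma>" "nats \<sigma> ''j'' [] = j" "nats \<sigma> ''y'' [] = y"
    "0 < max_signals G" "0 < agents G" "\<theta> < states G"
  shows "reals (fst (exec weights_com \<sigma>)) ''weight'' [\<theta>] = weight G (consistent \<sigma>) j y \<theta>" (is "?value")
    and "snd (exec weights_com \<sigma>) \<le> 6 * (states G * (agents G * max_signals G))" (is "?cost")
proof -
  let ?P = "\<lambda>v \<tau>. \<forall>\<theta><v. reals \<tau> ''weight'' [\<theta>] = weight G (consistent \<sigma>) j y \<theta>"
  have "?P (nval \<sigma> (nv ''states'')) (fst (exec weights_com \<sigma>)) \<and>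
    snd (exec weights_com \<sigma>) \<le> nops (nv ''states'') +
      nval \<sigma> (nv ''states'') * Suc (1 + 4 * (agents G * max_signals G))"
    unfolding weights_com_def
  proof (rule exec_For, goal_cases)
    case 1
    then show ?case by simp
  next
    case (2 v \<tau>)
    let ?t = "nset ''th'' [] v \<tau>"
    have "inputs G i x \<tau>" using inputs_frame[OF 2(3) assms(1)] by simp
    then have it: "inputs G i x ?t" by (simp add: inputs_def)
    have F: "consistent ?t = consistent \<sigma>"
      using 2(3) by (simp add: frame_def consistent_def fun_eq_iff)
    have vars: "nats ?t ''j'' [] = j" "nats ?t ''y'' [] = y" "nats ?t ''th'' [] = v"
      using 2(3) assms by (simp_all add: frame_def)
    show ?case
      using exec_weight_com[OF it vars assms(4)] 2(2) by (auto simp: F less_Suc_eq)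
  qed
  then have "?P (states G) (fst (exec weights_com \<sigma>))"
    and c: "snd (exec weights_com \<sigma>) \<le> states G * Suc (1 + 4 * (agents G * max_signals G))"
    by (simp_all add: inputs_simps[OF assms(1)])
  then show ?value using assms(6) by simp
  have "Suc (1 + 4 * (agents G * max_signals G)) \<le> 6 * (agents G * max_signals G)"
    using mult_le_mono[of 1 "agents G" 1 "max_signals G"] assms(4,5) by simp
  then have "states G * Suc (1 + 4 * (agents G * max_signals G))
      \<le> states G * (6 * (agents G * max_signals G))"
    by (rule mult_le_mono2)
  with c show ?cost by linarith
qed

lemma exec_value_com:
  assumes "inputs G i x \<sigma>" "nats \<sigma> ''j'' [] = j" "nats \<sigma> ''a'' [] = a"
  shows "reals (fst (exec value_com \<sigma>)) ''value'' = (reals \<sigma> ''value'')([a] :=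
      \<Sum>\<theta><states G. reals \<sigma> ''weight'' [\<theta>] * utility G j a \<theta>)" (is "?value")
    and "snd (exec value_com \<sigma>) \<le> 3 * states G" (is "?cost")
proof -
  let ?e = "nv ''states''"
  let ?c = "RSet ''value'' [nv ''a''] (RAdd (RGet ''value'' [nv ''a''])
         (RMul (RGet ''weight'' [nv ''th'']) (RGet ''utility'' [nv ''j'', nv ''a'', nv ''th''])))"
  let ?s = "rset ''value'' [a] 0 \<sigma>"
  let ?P = "\<lambda>v \<tau>. reals \<tau> ''value'' = (reals \<sigma> ''value'')([a] :=
      \<Sum>\<theta><v. reals \<sigma> ''weight'' [\<theta>] * utility G j a \<theta>)"
  have inp: "inputs G i x ?s" using assms(1) by (simp add: inputs_def)
  \<comment> \<open>One addition and one multiplication per state, and one unit for the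
    counter.\<close>
  have "?P (nval ?s ?e) (fst (exec (For ''th'' ?e ?c) ?s)) \<and>
    snd (exec (For ''th'' ?e ?c) ?s) \<le> nops ?e + nval ?s ?e * Suc 2"
  proof (rule exec_For, goal_cases)
    case 1
    then show ?case by simp
  next
    case (2 v \<tau>)
    have it: "inputs G i x \<tau>" using inputs_frame[OF 2(3) inp] by simp
    have "nats \<tau> ''j'' [] = j" "nats \<tau> ''a'' [] = a" "reals \<tau> ''weight'' = reals \<sigma> ''weight''"
      using 2(3) assms by (simp_all add: frame_def)
    with 2(2) show ?case
      by (auto simp: inputs_simps[OF it] fun_eq_iff)
  qed
  moreover have "nval ?s ?e = states G"
    using assms by (simp add: inputs_simps)
  ultimately show ?value ?cost
    using assms(3) by (simp_all add: value_com_def)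
qed

lemma exec_values_com:
  assumes "inputs G i x \<sigma>" "nats \<sigma> ''j'' [] = j" "j < agents G" "0 < states G"
  shows "\<forall>a<actions G j. reals (fst (exec values_com \<sigma>)) ''value'' [a] =
      (\<Sum>\<theta><states G. reals \<sigma> ''weight'' [\<theta>] * utility G j a \<theta>)" (is "?value")
    and "snd (exec values_com \<sigma>) \<le> 4 * (max_actions G * states G)" (is "?cost")
proof -
  let ?e = "NGet ''actions'' [nv ''j'']"
  let ?P = "\<lambda>v \<tau>. \<forall>a<v. reals \<tau> ''value'' [a] =
      (\<Sum>\<theta><states G. reals \<sigma> ''weight'' [\<theta>] * utility G j a \<theta>)"
  have "?P (nval \<sigma> ?e) (fst (exec values_com \<sigma>)) \<and>
    snd (exec values_com \<sigma>) \<le> nops ?e + nval \<sigma> ?e * Suc (3 * states G)"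
    unfolding values_com_def
  proof (rule exec_For, goal_cases)
    case 1
    then show ?case by simp
  next
    case (2 v \<tau>)
    let ?t = "nset ''a'' [] v \<tau>"
    have "inputs G i x \<tau>" using inputs_frame[OF 2(3) assms(1)] by simp
    then have it: "inputs G i x ?t" by (simp add: inputs_def)
    have vars: "nats ?t ''j'' [] = j" "nats ?t ''a'' [] = v"
        "reals ?t ''weight'' = reals \<sigma> ''weight''"
      using 2(3) assms by (simp_all add: frame_def)
    show ?case
      using exec_value_com[OF it vars(1,2)] 2(2) vars(3) by (auto simp: less_Suc_eq)
  qed
  moreover have "nval \<sigma> ?e = actions G j"
    using assms by (simp add: inputs_simps)
  moreover have "actions G j * Suc (3 * states G) \<le> max_actions G * (4 * states G)"
    using assms(4) by (intro mult_le_mono actions_le assms(3)) simp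
  ultimately show ?value ?cost by simp_all
qed

text \<open>The premises are exactly what a left-to-right scan with strict replacement establishes
  about its final candidate.\<close>

lemma Least_is_arg_max_eq:
  fixes f :: "nat \<Rightarrow> 'a::linorder"
  assumes "b < n" "\<And>a. a < n \<Longrightarrow> f a \<le> f b" "\<And>a. a < b \<Longrightarrow> f a < f b"
  shows "(LEAST a. is_arg_max f (\<lambda>a. a < n) a) = b"
proof (rule Least_equality)
  show "is_arg_max f (\<lambda>a. a < n) b"
    using assms(1,2) leD unfolding is_arg_max_def by blast
  show "b \<le> a" if "is_arg_max f (\<lambda>a. a < n) a" for a
    using that assms(1) assms(3)[of a] by (auto simp: is_arg_max_def not_less[symmetric])
qed

lemma exec_argmax_com:
  assumes "inputs G i x \<sigma>" "nats \<sigma> ''j'' [] = j" "nats \<sigma> ''y'' [] = y"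
    "j < agents G" "0 < actions G j"
  shows "nats (fst (exec argmax_com \<sigma>)) ''predicted'' = (nats \<sigma> ''predicted'')([j, y] :=
      LEAST a. is_arg_max (\<lambda>a. reals \<sigma> ''value'' [a]) (\<lambda>a. a < actions G j) a)" (is "?value")
    and "snd (exec argmax_com \<sigma>) \<le> max_actions G" (is "?cost")
proof -
  let ?E = "\<lambda>a. reals \<sigma> ''value'' [a]"
  let ?e = "NGet ''actions'' [nv ''j'']"
  let ?c = "If (RLess (RGet ''value'' [NGet ''predicted'' [nv ''j'', nv ''y'']]) (RGet ''value'' [nv ''a'']))
         (NSet ''predicted'' [nv ''j'', nv ''y''] (nv ''a''))
         Skip"
  let ?s = "nset ''predicted'' [j, y] 0 \<sigma>"
  \<comment> \<open>\<open>b\<close> is the least maximiser among the first \<open>v\<close>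
    actions. For \<open>v = 0\<close> there is none and 0 is a placeholder; the first iteration
    compares action 0 with itself and keeps it.\<close>
  let ?P = "\<lambda>v \<tau>. \<exists>b. nats \<tau> ''predicted'' = (nats \<sigma> ''predicted'')([j, y] := b) \<and>
      (v = 0 \<longrightarrow> b = 0) \<and> (0 < v \<longrightarrow> b < v) \<and> (\<forall>a<v. ?E a \<le> ?E b) \<and> (\<forall>a<b. ?E a < ?E b)"
  have inp: "inputs G i x ?s" using assms(1) by (simp add: inputs_def)
  have "?P (nval ?s ?e) (fst (exec (For ''a'' ?e ?c) ?s)) \<and>
    snd (exec (For ''a'' ?e ?c) ?s) \<le> nops ?e + nval ?s ?e * Suc 0"
  proof (rule exec_For, goal_cases)
    case 1
    then show ?case by auto
  next
    case (2 v \<tau>)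
    have vars: "nats \<tau> ''j'' [] = j" "nats \<tau> ''y'' [] = y" "reals \<tau> ''value'' = reals \<sigma> ''value''"
      using 2(3) assms by (simp_all add: frame_def)
    from 2(2) obtain b where b: "nats \<tau> ''predicted'' = (nats \<sigma> ''predicted'')([j, y] := b)"
      "v = 0 \<longrightarrow> b = 0" "0 < v \<longrightarrow> b < v" "\<forall>a<v. ?E a \<le> ?E b" "\<forall>a<b. ?E a < ?E b"
      by blast
    have "?P (Suc v) (fst (exec ?c (nset ''a'' [] v \<tau>)))"
    proof (cases "?E b < ?E v")
      case True
      have "nats (fst (exec ?c (nset ''a'' [] v \<tau>))) ''predicted'' = (nats \<sigma> ''predicted'')([j, y] := v)"
        using True b(1) vars by simp
      moreover have "\<forall>a<v. ?E a < ?E v" using True b(4) by (meson le_less_trans)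
      ultimately show ?thesis by (intro exI[of _ v]) (auto simp: less_Suc_eq)
    next
      case False
      then have "nats (fst (exec ?c (nset ''a'' [] v \<tau>))) ''predicted'' = (nats \<sigma> ''predicted'')([j, y] := b)"
        using b(1) vars by simp
      then show ?thesis using False b(2-5) by (intro exI[of _ b]) (auto simp: less_Suc_eq)
    qed
    then show ?case by (rule conjI) simp
  qed
  moreover have n: "nval ?s ?e = actions G j"
    using assms by (simp add: inputs_simps)
  ultimately obtain b where
    b: "nats (fst (exec (For ''a'' ?e ?c) ?s)) ''predicted'' = (nats \<sigma> ''predicted'')([j, y] := b)"
      "b < actions G j" "\<forall>a<actions G j. ?E a \<le> ?E b" "\<forall>a<b. ?E a < ?E b"
    and cost: "snd (exec (For ''a'' ?e ?c) ?s) \<le> actions G j"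
    using assms(5) by auto
  have "(LEAST a. is_arg_max ?E (\<lambda>a. a < actions G j) a) = b"
    using b by (intro Least_is_arg_max_eq) auto
  then show ?value ?cost
    using b(1) cost actions_le[OF assms(4)] assms by (simp_all add: argmax_com_def)
qed

lemma is_arg_max_cong:
  assumes "\<And>a. P a \<Longrightarrow> f a = g a"
  shows "is_arg_max f P = is_arg_max g P"
  using assms by (auto simp: is_arg_max_def fun_eq_iff)

lemma exec_predict_body:
  assumes "inputs G i x \<sigma>" "nats \<sigma> ''j'' [] = j" "nats \<sigma> ''y'' [] = y"
    "j < agents G" "0 < actions G j" "0 < max_signals G" "0 < states G" "0 < max_actions G"
  shows "nats (fst (exec (Seq weights_com (Seq values_com argmax_com)) \<sigma>)) ''predicted'' =
      (nats \<sigma> ''predicted'')([j, y] := predict G (consistent \<sigma>) j y)" (is "?value")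
    and "snd (exec (Seq weights_com (Seq values_com argmax_com)) \<sigma>)
      \<le> 11 * (max_actions G * states G * agents G * max_signals G)" (is "?cost")
proof -
  let ?s1 = "fst (exec weights_com \<sigma>)"
  let ?s2 = "fst (exec values_com ?s1)"
  have n: "0 < agents G" using assms(4) by simp
  have f1: "frame weights_com \<sigma> ?s1" and f2: "frame values_com ?s1 ?s2"
    by (rule frame_exec)+
  have i1: "inputs G i x ?s1" using inputs_frame[OF f1 assms(1)] by simp
  have i2: "inputs G i x ?s2" using inputs_frame[OF f2 i1] by simp
  have v1: "nats ?s1 ''j'' [] = j" "nats ?s1 ''y'' [] = y" "nats ?s1 ''predicted'' = nats \<sigma> ''predicted''"
    using f1 assms by (simp_all add: frame_def)
  have v2: "nats ?s2 ''j'' [] = j" "nats ?s2 ''y'' [] = y" "nats ?s2 ''predicted'' = nats \<sigma> ''predicted''"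
    using f2 v1 by (simp_all add: frame_def)
  note w = exec_weights_com[OF assms(1,2,3,6) n]
  note u = exec_values_com[OF i1 v1(1) assms(4,7)]
  note m = exec_argmax_com[OF i2 v2(1,2) assms(4,5)]
  have "is_arg_max (\<lambda>a. reals ?s2 ''value'' [a]) (\<lambda>a. a < actions G j) =
    is_arg_max (\<lambda>a. \<Sum>\<theta><states G. weight G (consistent \<sigma>) j y \<theta> * utility G j a \<theta>)
        (\<lambda>a. a < actions G j)"
    using u(1) by (intro is_arg_max_cong) (auto simp: w(1) intro!: sum.cong)
  then show ?value
    using m(1) v2(3) by (simp add: predict_def)
  \<comment> \<open>All four factors are at least 1, so each of the three costs is at most a
    multiple of \<open>?Q\<close>; the coefficients add up to 6 + 4 + 1 = 11.\<close>
  let ?A = "max_actions G" and ?S = "states G" and ?M = "max_signals G" and ?n = "agents G"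
  let ?Q = "?A * ?S * ?n * ?M"
  have "1 * (?S * ?n * ?M) \<le> ?A * (?S * ?n * ?M)" "?A * ?S * 1 \<le> ?A * ?S * (?n * ?M)"
      "?A * 1 \<le> ?A * (?S * ?n * ?M)"
    using assms n by (intro mult_le_mono le_refl; simp add: Suc_le_eq)+
  then have "?S * (?n * ?M) \<le> ?Q" "?A * ?S \<le> ?Q" "?A \<le> ?Q"
    by (simp_all add: mult_ac)
  \<comment> \<open>The cost bound is stated for some state in range; here that state is 0.\<close>
  moreover have "snd (exec weights_com \<sigma>) \<le> 6 * (?S * (?n * ?M))" using w(2)[OF assms(7)] .
  ultimately have "snd (exec weights_com \<sigma>) + (snd (exec values_com ?s1) + snd (exec argmax_com ?s2))
      \<le> 11 * ?Q"
    using u(2) m(2) by linarith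
  then show ?cost unfolding snd_exec_Seq .
qed

lemma exec_predict_com:
  assumes inp: "inputs G i x \<sigma>" and act: "\<forall>j<agents G. 0 < actions G j"
    and pos: "0 < max_signals G" "0 < states G" "0 < max_actions G" "0 < agents G"
  shows "\<And>k z. k < agents G \<Longrightarrow> z < signals G k \<Longrightarrow>
      nats (fst (exec predict_com \<sigma>)) ''predicted'' [k, z] = predict G (consistent \<sigma>) k z"
    (is "PROP ?value")
    and "snd (exec predict_com \<sigma>)
      \<le> 13 * (max_actions G * states G * (agents G)\<^sup>2 * (max_signals G)\<^sup>2)" (is "?cost")
proof -
  let ?Q = "max_actions G * states G * agents G * max_signals G"
  let ?ey = "NGet ''signals'' [nv ''j'']"
  let ?c = "Seq weights_com (Seq values_com argmax_com)"
  let ?cy = "For ''y'' ?ey ?c"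
  let ?P = "\<lambda>v \<tau>. \<forall>k z. k < v \<and> z < signals G k \<longrightarrow>
    nats \<tau> ''predicted'' [k, z] = predict G (consistent \<sigma>) k z"
  have "?P (nval \<sigma> (nv ''agents'')) (fst (exec predict_com \<sigma>)) \<and> snd (exec predict_com \<sigma>)
      \<le> nops (nv ''agents'') + nval \<sigma> (nv ''agents'') * Suc (max_signals G * Suc (11 * ?Q))"
    unfolding predict_com_def
  proof (rule exec_For, goal_cases)
    case 1
    then show ?case by simp
  next
    case (2 j \<tau>)
    let ?t = "nset ''j'' [] j \<tau>"
    have "inputs G i x \<tau>" using inputs_frame[OF 2(3) inp] by simp
    then have it: "inputs G i x ?t" by (simp add: inputs_def)
    have j: "j < agents G" using 2(1) by (simp add: inputs_simps[OF inp])
    \<comment> \<open>Prediction never writes \<open>excluded\<close>, so all predictions of one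
      execution use the same \<open>F\<close>.\<close>
    have F: "consistent ?t = consistent \<sigma>"
      using 2(3) by (simp add: frame_def consistent_def fun_eq_iff)
    \<comment> \<open>The inner invariant fixes the entries of all agents, so that predictions made
      for earlier agents survive.\<close>
    let ?R = "\<lambda>v \<rho>. \<forall>k z. nats \<rho> ''predicted'' [k, z] =
      (if k = j \<and> z < v then predict G (consistent \<sigma>) k z else nats \<tau> ''predicted'' [k, z])"
    have "?R (nval ?t ?ey) (fst (exec ?cy ?t)) \<and>
      snd (exec ?cy ?t) \<le> nops ?ey + nval ?t ?ey * Suc (11 * ?Q)"
    proof (rule exec_For, goal_cases)
      case 1
      then show ?case by simp
    next
      case (2 y \<rho>)
      let ?u = "nset ''y'' [] y \<rho>"
      have "inputs G i x \<rho>" using inputs_frame[OF 2(3) it] by simp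
      then have iu: "inputs G i x ?u" by (simp add: inputs_def)
      have "consistent ?u = consistent ?t"
        using 2(3) by (simp add: frame_def consistent_def fun_eq_iff)
      then have F': "consistent ?u = consistent \<sigma>" using F by simp
      have vars: "nats ?u ''j'' [] = j" "nats ?u ''y'' [] = y"
        using 2(3) by (simp_all add: frame_def)
      note b = exec_predict_body[OF iu vars j act[rule_format, OF j] pos(1,2,3)]
      from b(1) 2(2) b(2) show ?case
        unfolding F' by (auto simp: less_Suc_eq simp del: fst_exec_Seq snd_exec_Seq)
    qed
    moreover have "nval ?t ?ey = signals G j"
      using inputs_simps(5)[OF it, of j] by simp
    ultimately have R: "?R (signals G j) (fst (exec ?cy ?t))"
      and "snd (exec ?cy ?t) \<le> signals G j * Suc (11 * ?Q)"
      by (simp_all only: nops.simps list.map sum_list.Nil sum_list.Cons add_0 simp_thms)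
    then have "snd (exec ?cy ?t) \<le> max_signals G * Suc (11 * ?Q)"
      using signals_le[OF j] by (meson le_trans mult_le_mono1)
    with R 2(2) show ?case by (auto simp: less_Suc_eq)
  qed
  then have "?P (agents G) (fst (exec predict_com \<sigma>)) \<and>
      snd (exec predict_com \<sigma>) \<le> agents G * Suc (max_signals G * Suc (11 * ?Q))"
    unfolding nval.simps list.map inputs_simps[OF inp] nops.simps sum_list.Nil add_0 .
  then have v: "?P (agents G) (fst (exec predict_com \<sigma>))"
    and c: "snd (exec predict_com \<sigma>) \<le> agents G * Suc (max_signals G * Suc (11 * ?Q))"
    by blast+
  show "PROP ?value" using v by blast
  \<comment> \<open>The two surplus terms \<open>k\<close> and 1 are each at most
    \<open>k * q\<close>, which turns 11 into 13. The loops over agents and signals contribute the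
    second factors of \<open>agents G\<close> and \<open>max_signals G\<close>, hence the
    squares.\<close>
  have Suc_le: "Suc (k * Suc (11 * q)) \<le> 13 * (k * q)" if "0 < k" "0 < q" for k q :: nat
    using mult_le_mono[of 1 k 1 q] mult_le_mono2[of 1 q k] that by (simp add: Suc_le_eq)
  have "0 < ?Q" using pos by simp
  from Suc_le[OF pos(1) this]
  have "Suc (max_signals G * Suc (11 * ?Q)) \<le> 13 * (max_signals G * ?Q)" .
  then have "agents G * Suc (max_signals G * Suc (11 * ?Q)) \<le> agents G * (13 * (max_signals G * ?Q))"
    by (rule mult_le_mono2)
  with c show ?cost by (simp add: power2_eq_square mult_ac)
qed

text \<open>Marks are set and never cleared, so consistency can only shrink: a signal survives if it
  was consistent before and its prediction matches the observation.\<close>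

lemma exec_exclude_com:
  assumes inp: "inputs G i x \<sigma>" and M: "0 < max_signals G"
  shows "\<And>k z. consistent (fst (exec exclude_com \<sigma>)) k z \<longleftrightarrow> consistent \<sigma> k z \<and>
      (k < agents G \<and> z < signals G k \<longrightarrow> nats \<sigma> ''predicted'' [k, z] = nats \<sigma> ''observed'' [k])"
    (is "PROP ?value")
    and "snd (exec exclude_com \<sigma>) \<le> 2 * (agents G * max_signals G)" (is "?cost")
proof -
  let ?ey = "NGet ''signals'' [nv ''j'']"
  let ?c = "If (BAnd (BNot (NLess (NGet ''predicted'' [nv ''j'', nv ''y'']) (NGet ''observed'' [nv ''j''])))
               (BNot (NLess (NGet ''observed'' [nv ''j'']) (NGet ''predicted'' [nv ''j'', nv ''y'']))))
       Skip
       (NSet ''excluded'' [nv ''j'', nv ''y''] (NConst 1))"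
  let ?cy = "For ''y'' ?ey ?c"
  let ?same = "\<lambda>k z. nats \<sigma> ''predicted'' [k, z] = nats \<sigma> ''observed'' [k]"
  let ?P = "\<lambda>v \<tau>. \<forall>k z. consistent \<tau> k z \<longleftrightarrow>
    consistent \<sigma> k z \<and> (k < v \<and> z < signals G k \<longrightarrow> ?same k z)"
  have "?P (nval \<sigma> (nv ''agents'')) (fst (exec exclude_com \<sigma>)) \<and> snd (exec exclude_com \<sigma>)
      \<le> nops (nv ''agents'') + nval \<sigma> (nv ''agents'') * Suc (max_signals G)"
    unfolding exclude_com_def
  proof (rule exec_For, goal_cases)
    case 1
    then show ?case by simp
  next
    case (2 j \<tau>)
    let ?t = "nset ''j'' [] j \<tau>"
    have "inputs G i x \<tau>" using inputs_frame[OF 2(3) inp] by simp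
    then have it: "inputs G i x ?t" by (simp add: inputs_def)
    have j: "j < agents G" using 2(1) by (simp add: inputs_simps[OF inp])
    have same: "nats ?t ''predicted'' = nats \<sigma> ''predicted''" "nats ?t ''observed'' = nats \<sigma> ''observed''"
      using 2(3) by (simp_all add: frame_def)
    let ?R = "\<lambda>v \<rho>. \<forall>k z. consistent \<rho> k z \<longleftrightarrow> consistent \<tau> k z \<and> (k = j \<and> z < v \<longrightarrow> ?same k z)"
    have "?R (nval ?t ?ey) (fst (exec ?cy ?t)) \<and>
      snd (exec ?cy ?t) \<le> nops ?ey + nval ?t ?ey * Suc 0"
    proof (rule exec_For, goal_cases)
      case 1
      then show ?case by (simp add: consistent_def)
    next
      case (2 y \<rho>)
      have vars: "nats \<rho> ''j'' [] = j" "nats \<rho> ''predicted'' = nats \<sigma> ''predicted''"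
          "nats \<rho> ''observed'' = nats \<sigma> ''observed''"
        using 2(3) same by (simp_all add: frame_def)
      show ?case
      proof (cases "?same j y")
        case True
        then show ?thesis
          using 2(2) vars by (auto simp: consistent_def less_Suc_eq)
      next
        case False
        then show ?thesis
          using 2(2) vars by (auto simp: consistent_def less_Suc_eq)
      qed
    qed
    moreover have "nval ?t ?ey = signals G j"
      using inputs_simps(5)[OF it, of j] by simp
    ultimately have "?R (signals G j) (fst (exec ?cy ?t))" "snd (exec ?cy ?t) \<le> max_signals G"
      using signals_le[OF j] by simp_all
    with 2(2) show ?case by (auto simp: less_Suc_eq)
  qed
  then have v: "?P (agents G) (fst (exec exclude_com \<sigma>))"
    and c: "snd (exec exclude_com \<sigma>) \<le> agents G * Suc (max_signals G)"
    by (simp_all add: inputs_simps[OF inp])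
  show "PROP ?value" using v by blast
  have "agents G * Suc (max_signals G) \<le> agents G * (2 * max_signals G)"
    using M by (intro mult_le_mono2) linarith
  with c show ?cost by linarith
qed

text \<open>One step of the recursion on the sets of consistent signals: the last observations
  refine the old sets, and the new predictions are based on the refined ones.\<close>

lemma exec_bayes_com:
  assumes inp: "inputs G i x \<sigma>" and act: "\<forall>j<agents G. 0 < actions G j"
    and pos: "0 < max_signals G" "0 < states G" "0 < max_actions G" "0 < agents G"
    and ix: "i < agents G" "x < signals G i"
  defines "\<sigma>' \<equiv> fst (exec bayes_com \<sigma>)"
  shows "inputs G i x \<sigma>'"
    and "\<And>k z. consistent \<sigma>' k z \<longleftrightarrow> consistent \<sigma> k z \<and>
      (k < agents G \<and> z < signals G k \<longrightarrow> nats \<sigma> ''predicted'' [k, z] = nats \<sigma> ''observed'' [k])"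
    and "\<And>k z. k < agents G \<Longrightarrow> z < signals G k \<Longrightarrow>
      nats \<sigma>' ''predicted'' [k, z] = predict G (consistent \<sigma>') k z"
    and "nats \<sigma>' ''output'' [] = predict G (consistent \<sigma>') i x"
    and "snd (exec bayes_com \<sigma>)
      \<le> 15 * (max_actions G * states G * (agents G)\<^sup>2 * (max_signals G)\<^sup>2)"
proof -
  let ?s1 = "fst (exec exclude_com \<sigma>)"
  let ?s2 = "fst (exec predict_com ?s1)"
  have f1: "frame exclude_com \<sigma> ?s1" and f2: "frame predict_com ?s1 ?s2"
    by (rule frame_exec)+
  have i1: "inputs G i x ?s1" using inputs_frame[OF f1 inp] by simp
  have i2: "inputs G i x ?s2" using inputs_frame[OF f2 i1] by simp
  have s': "\<sigma>' = nset ''output'' [] (nats ?s2 ''predicted'' [i, x]) ?s2"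
    by (simp add: \<sigma>'_def bayes_com_def inputs_simps[OF i2])
  show "inputs G i x \<sigma>'" using i2 by (simp add: inputs_def s')
  have F: "consistent \<sigma>' = consistent ?s1"
    using frame_nats[OF f2, of "''excluded''"] by (simp add: s' consistent_def fun_eq_iff)
  note e = exec_exclude_com[OF inp pos(1)]
  note p = exec_predict_com[OF i1 act pos]
  show "consistent \<sigma>' k z \<longleftrightarrow> consistent \<sigma> k z \<and>
      (k < agents G \<and> z < signals G k \<longrightarrow> nats \<sigma> ''predicted'' [k, z] = nats \<sigma> ''observed'' [k])"
    for k z unfolding F by (rule e(1))
  show "nats \<sigma>' ''predicted'' [k, z] = predict G (consistent \<sigma>') k z"
    if "k < agents G" "z < signals G k" for k z
    using p(1)[OF that] by (simp add: s' F[symmetric])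
  show "nats \<sigma>' ''output'' [] = predict G (consistent \<sigma>') i x"
    using p(1)[OF ix] by (simp add: s' F[symmetric])
  let ?Q = "max_actions G * states G * agents G * max_signals G"
  \<comment> \<open>The cost of exclusion, \<open>2 * (agents G * max_signals G)\<close>, is
    absorbed into the main term, giving 13 + 2 = 15.\<close>
  have "agents G * max_signals G * 1 \<le> agents G * max_signals G * ?Q"
    using pos by (intro mult_le_mono2) (simp add: Suc_le_eq)
  then have "agents G * max_signals G
      \<le> max_actions G * states G * (agents G)\<^sup>2 * (max_signals G)\<^sup>2"
    by (simp add: power2_eq_square mult_ac)
  moreover have "snd (exec bayes_com \<sigma>) = snd (exec exclude_com \<sigma>) + snd (exec predict_com ?s1)"
    by (simp add: bayes_com_def)
  ultimately show "snd (exec bayes_com \<sigma>)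
      \<le> 15 * (max_actions G * states G * (agents G)\<^sup>2 * (max_signals G)\<^sup>2)"
    using e(2) p(2) by linarith
qed

section \<open>Posteriors\<close>

text \<open>Integrating over the prior, only the mass at \<theta> contributes, with the product law
  of the signals in that state as its factor.\<close>

lemma prob_joint:
  "measure_pmf.prob (joint G) {\<omega>. fst \<omega> = \<theta> \<and> snd \<omega> \<in> H} =
     pmf (prior G) \<theta> * measure_pmf.prob (Pi_pmf {..<agents G} 0 (\<lambda>i. signal_law G i \<theta>)) H"
proof -
  let ?X = "{\<omega>. fst \<omega> = \<theta> \<and> snd \<omega> \<in> H}"
  let ?q = "\<lambda>\<theta>'. Pi_pmf {..<agents G} 0 (\<lambda>i. signal_law G i \<theta>')"
  have "emeasure (joint G) ?X = (\<integral>\<^sup>+\<theta>'. emeasure (?q \<theta>) H * indicator {\<theta>} \<theta>' \<partial>prior G)"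
    unfolding joint_def emeasure_bind_pmf
    by (intro nn_integral_cong) (auto simp: indicator_def vimage_def)
  also have "\<dots> = emeasure (?q \<theta>) H * emeasure (prior G) {\<theta>}"
    by (subst nn_integral_cmult_indicator) auto
  finally show ?thesis
    by (simp add: measure_pmf.emeasure_eq_measure ennreal_mult'[symmetric] measure_pmf_single
        mult.commute)
qed

text \<open>Bayes' rule. Utility depends on the state alone, so the expectation reduces to the
  conditional law of the state, which lives on a finite set. The second premise ensures that
  conditioning on \<open>H\<close> is meaningful.\<close>

lemma expected_utility_eq:
  assumes "set_pmf (prior G) \<subseteq> {..<states G}" "H \<inter> snd ` set_pmf (joint G) \<noteq> {}"
  shows "expected_utility G i H a =
    (\<Sum>\<theta><states G. measure_pmf.prob (joint G) {\<omega>. fst \<omega> = \<theta> \<and> snd \<omega> \<in> H} * utility G i a \<theta>)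
      / measure_pmf.prob (joint G) {\<omega>. snd \<omega> \<in> H}"
proof -
  let ?S = "{\<omega>. snd \<omega> \<in> H} :: (nat \<times> (nat \<Rightarrow> nat)) set"
  have ne: "set_pmf (joint G) \<inter> ?S \<noteq> {}" using assms(2) by auto
  let ?c = "cond_pmf (joint G) ?S"
  have sub: "fst ` set_pmf ?c \<subseteq> {..<states G}"
    using ne assms(1) by (auto simp: joint_def)
  have pmf: "pmf (map_pmf fst ?c) \<theta> =
    measure_pmf.prob (joint G) {\<omega>. fst \<omega> = \<theta> \<and> snd \<omega> \<in> H} / measure_pmf.prob (joint G) ?S" for \<theta>
  proof -
    have "pmf (map_pmf fst ?c) \<theta> = measure (uniform_measure (joint G) ?S) (fst -` {\<theta>})"
      by (simp add: pmf_map cond_pmf.rep_eq[OF ne])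
    also have "\<dots> = measure_pmf.prob (joint G) (?S \<inter> fst -` {\<theta>}) / measure_pmf.prob (joint G) ?S"
      using emeasure_measure_pmf_not_zero[OF ne] by (subst measure_uniform_measure) auto
    also have "?S \<inter> fst -` {\<theta>} = {\<omega>. fst \<omega> = \<theta> \<and> snd \<omega> \<in> H}" by auto
    finally show ?thesis .
  qed
  have "expected_utility G i H a = measure_pmf.expectation (map_pmf fst ?c) (utility G i a)"
    by (simp add: expected_utility_def)
  also have "\<dots> = (\<Sum>\<theta><states G. utility G i a \<theta> * pmf (map_pmf fst ?c) \<theta>)"
    using sub by (intro integral_measure_pmf_real) auto
  finally show ?thesis
    by (simp add: pmf sum_divide_distrib mult.commute)
qed

lemma cond_pmf_Int_set_pmf:
  assumes "set_pmf p \<inter> A \<noteq> {}"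
  shows "cond_pmf p (set_pmf p \<inter> A) = cond_pmf p A"
proof (rule pmf_eqI)
  fix x
  have "set_pmf p \<inter> (set_pmf p \<inter> A) \<noteq> {}" using assms by auto
  then show "pmf (cond_pmf p (set_pmf p \<inter> A)) x = pmf (cond_pmf p A) x"
    using measure_Int_set_pmf[of p A] assms by (auto simp: pmf_cond set_pmf_iff Int_commute)
qed

text \<open>Conditioning sees an event only through its trace on the support. This is needed because
  the event described by \<open>F\<close> and the true history event are only shown to agree on
  profiles of positive probability.\<close>

lemma optimal_action_cong:
  assumes "set_pmf (prior G) \<subseteq> {..<states G}" "H \<inter> snd ` set_pmf (joint G) \<noteq> {}"
    and "\<And>s. s \<in> snd ` set_pmf (joint G) \<Longrightarrow> s \<in> H \<longleftrightarrow> s \<in> H'"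
  shows "optimal_action G i H = optimal_action G i H'"
proof -
  have "set_pmf (joint G) \<inter> {\<omega>. snd \<omega> \<in> H} = set_pmf (joint G) \<inter> {\<omega>. snd \<omega> \<in> H'}"
    using assms(3) by auto
  then have "cond_pmf (joint G) {\<omega>. snd \<omega> \<in> H} = cond_pmf (joint G) {\<omega>. snd \<omega> \<in> H'}"
    using cond_pmf_Int_set_pmf[of "joint G" "{\<omega>. snd \<omega> \<in> H}"]
      cond_pmf_Int_set_pmf[of "joint G" "{\<omega>. snd \<omega> \<in> H'}"] assms(2) by force
  then show ?thesis by (simp add: optimal_action_def expected_utility_def[abs_def])
qed

text \<open>The event on signal profiles is a product set, so its probability given the state is the
  product of the coordinate probabilities.\<close>

lemma prob_joint_consistent:
  assumes "wf_game G" "j < agents G" "\<theta> < states G"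
  shows "measure_pmf.prob (joint G)
     {\<omega>. fst \<omega> = \<theta> \<and> snd \<omega> \<in> {s. s j = y \<and> (\<forall>k\<in>nbrs G j. k \<noteq> j \<longrightarrow> F k (s k))}} = weight G F j y \<theta>"
proof -
  \<comment> \<open>Unobserved coordinates are unconstrained and contribute the factor 1.\<close>
  define B where "B k = (if k = j then {y} else if k \<in> nbrs G j then {z. F k z} else UNIV)" for k
  have sub: "nbrs G j \<subseteq> {..<agents G}" using assms by (simp add: wf_game_def)
  have H: "{s. s j = y \<and> (\<forall>k\<in>nbrs G j. k \<noteq> j \<longrightarrow> F k (s k))} = Pi {..<agents G} B"
    using sub assms(2) by (auto simp: B_def Pi_def split: if_splits)
  have mass: "measure_pmf.prob (signal_law G k \<theta>) {z. F k z} = consistent_mass G F \<theta> k"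
    if "k < agents G" for k
  proof -
    have "set_pmf (signal_law G k \<theta>) \<subseteq> {..<signals G k}"
      using that assms by (simp add: wf_game_def)
    then have "measure_pmf.prob (signal_law G k \<theta>) {z. F k z}
      = measure_pmf.prob (signal_law G k \<theta>) {z\<in>{..<signals G k}. F k z}"
      by (intro measure_prob_cong_0) (auto simp: set_pmf_iff)
    then show ?thesis
      by (simp add: measure_measure_pmf_finite consistent_mass_def sum.inter_filter
          flip: lessThan_iff)
  qed
  have "(\<Prod>k<agents G. measure_pmf.prob (signal_law G k \<theta>) (B k)) =
    pmf (signal_law G j \<theta>) y * (\<Prod>k\<in>{..<agents G} - {j}. measure_pmf.prob (signal_law G k \<theta>) (B k))"
    using assms(2) by (subst prod.remove[of _ j]) (auto simp: B_def measure_pmf_single)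
  also have "(\<Prod>k\<in>{..<agents G} - {j}. measure_pmf.prob (signal_law G k \<theta>) (B k)) =
    (\<Prod>k\<in>{..<agents G} - {j}. if k \<in> nbrs G j \<and> k \<noteq> j then consistent_mass G F \<theta> k else 1)"
    by (intro prod.cong) (auto simp: B_def mass)
  \<comment> \<open>Putting \<open>j\<close> back into the index set multiplies by 1.\<close>
  also have "\<dots> = (\<Prod>k<agents G. if k \<in> nbrs G j \<and> k \<noteq> j then consistent_mass G F \<theta> k else 1)"
    using assms(2) by (subst (2) prod.remove[of _ j]) auto
  finally show ?thesis
    unfolding H prob_joint by (simp add: measure_Pi_pmf_Pi weight_def mult.assoc)
qed

text \<open>The expected utility is the weighted sum divided by the probability of the event, which
  is positive because \<open>s\<close> lies in it; dividing by a positive constant preserves the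
  order of the actions.\<close>

lemma predict_eq_optimal_action:
  assumes "wf_game G" "j < agents G" "s \<in> snd ` set_pmf (joint G)" "\<And>k. k \<in> nbrs G j \<Longrightarrow> F k (s k)"
  shows "predict G F j (s j) = optimal_action G j {s'. s' j = s j \<and> (\<forall>k\<in>nbrs G j. F k (s' k))}"
proof -
  let ?H = "{s'. s' j = s j \<and> (\<forall>k\<in>nbrs G j. k \<noteq> j \<longrightarrow> F k (s' k))}"
  let ?W = "measure_pmf.prob (joint G) {\<omega>. snd \<omega> \<in> ?H}"
  have prior: "set_pmf (prior G) \<subseteq> {..<states G}" using assms by (simp add: wf_game_def)
  have ne: "?H \<inter> snd ` set_pmf (joint G) \<noteq> {}" using assms(3,4) by auto
  \<comment> \<open>A condition on the signal of \<open>j\<close> herself already follows from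
    \<open>s' j = s j\<close>.\<close>
  have H: "{s'. s' j = s j \<and> (\<forall>k\<in>nbrs G j. F k (s' k))} = ?H"
    using assms(4) by auto
  have "set_pmf (joint G) \<inter> {\<omega>. snd \<omega> \<in> ?H} \<noteq> {}" using ne by auto
  then have "0 < ?W" by (simp add: measure_measure_pmf_not_zero zero_less_measure_iff)
  moreover have "expected_utility G j ?H =
    (\<lambda>a. (\<Sum>\<theta><states G. weight G F j (s j) \<theta> * utility G j a \<theta>) / ?W)"
    unfolding expected_utility_eq[OF prior ne, abs_def]
    by (intro ext arg_cong2[where f = "(/)"] sum.cong refl)
      (subst prob_joint_consistent[OF assms(1,2)]; simp)
  ultimately have "is_arg_max (expected_utility G j ?H) = is_arg_max
    (\<lambda>a. \<Sum>\<theta><states G. weight G F j (s j) \<theta> * utility G j a \<theta>)"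
    by (simp only: is_arg_max_def[abs_def] divide_less_cancel) simp
  then show ?thesis by (simp add: predict_def optimal_action_def H)
qed

section \<open>Induction over time: predictions are the Bayesian actions\<close>

lemma signals_in_support:
  assumes "wf_game G" "s \<in> snd ` set_pmf (joint G)" "k < agents G"
  shows "s k < signals G k"
proof -
  obtain \<theta> where "\<theta> \<in> set_pmf (prior G)"
      "s \<in> set_pmf (Pi_pmf {..<agents G} 0 (\<lambda>i. signal_law G i \<theta>))"
    using assms(2) by (auto simp: joint_def)
  with assms(1,3) show ?thesis
    by (force simp: wf_game_def set_Pi_pmf PiE_dflt_def)
qed

text \<open>
  The actions of agents outside \<open>nbrs G i\<close> are not observed, so nothing is known about their
  entries of \<open>F\<close>; transitivity ensures that these entries never matter.
\<close>

lemma consistent_iff_same_actions: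
  assumes wf: "wf_game G" and tr: "transitive_network G" and i: "i < agents G"
    and F0: "\<And>k z. F 0 k z"
    and FS: "\<And>t k z. k \<in> nbrs G i \<Longrightarrow> z < signals G k \<Longrightarrow>
      F (Suc t) k z \<longleftrightarrow> F t k z \<and> predict G (F t) k z = bayes_action G t k s"
    and s': "s' \<in> snd ` set_pmf (joint G)" and j: "j \<in> nbrs G i"
  shows "(\<forall>k\<in>nbrs G j. F t k (s' k)) \<longleftrightarrow>
    (\<forall>\<tau><t. \<forall>k\<in>nbrs G j. bayes_action G \<tau> k s' = bayes_action G \<tau> k s)"
  using s' j
\<comment> \<open>The hypothesis is needed for the neighbours \<open>k\<close> of \<open>j\<close>
  in place of \<open>j\<close>, and for the other profiles in the history event of
  \<open>k\<close>.\<close>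
proof (induction t arbitrary: s' j)
  case 0
  then show ?case using F0 by simp
next
  case (Suc t)
  let ?supp = "snd ` set_pmf (joint G)"
  have ag: "k < agents G" if "k \<in> nbrs G i" for k
    using wf i that by (auto simp: wf_game_def)
  have sub: "nbrs G k \<subseteq> nbrs G k'" if "k' \<in> nbrs G i" "k \<in> nbrs G k'" for k k'
    using tr ag[OF that(1)] that(2) unfolding transitive_network_def by blast
  have subi: "k \<in> nbrs G i" if "k \<in> nbrs G j" for k
    using tr i Suc.prems(2) that unfolding transitive_network_def by blast
  have prior: "set_pmf (prior G) \<subseteq> {..<states G}" using wf by (simp add: wf_game_def)
  \<comment> \<open>If \<open>s'\<close> has survived so far, \<open>k\<close> has the same
    observations under \<open>s'\<close> as under \<open>s\<close>. The event used for prediction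
    then agrees on the support with her history event under \<open>s'\<close>, so the prediction at
    her signal \<open>s' k\<close> is her true action there.\<close>
  have pred: "predict G (F t) k (s' k) = bayes_action G t k s'"
    if same: "\<forall>k\<in>nbrs G j. F t k (s' k)" and k: "k \<in> nbrs G j" for k
  proof -
    have ki: "k \<in> nbrs G i" using subi k .
    have Fk: "\<forall>l\<in>nbrs G k. F t l (s' l)"
      using same sub[OF Suc.prems(2) k] by blast
    then have eq: "\<forall>\<tau><t. \<forall>l\<in>nbrs G k. bayes_action G \<tau> l s' = bayes_action G \<tau> l s"
      using Suc.IH[OF Suc.prems(1) ki] by blast
    have "predict G (F t) k (s' k) = optimal_action G k {s''. s'' k = s' k \<and> (\<forall>l\<in>nbrs G k. F t l (s'' l))}"
      using Fk by (intro predict_eq_optimal_action[OF wf ag[OF ki] Suc.prems(1)]) auto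
    also have "\<dots> = optimal_action G k {s''. s'' k = s' k \<and>
        (\<forall>\<tau>\<in>{..<t}. \<forall>l\<in>nbrs G k. bayes_action G \<tau> l s'' = bayes_action G \<tau> l s')}"
    proof (rule optimal_action_cong[OF prior])
      show "{s''. s'' k = s' k \<and> (\<forall>l\<in>nbrs G k. F t l (s'' l))} \<inter> ?supp \<noteq> {}"
        using Fk Suc.prems(1) by blast
      show "s'' \<in> {s''. s'' k = s' k \<and> (\<forall>l\<in>nbrs G k. F t l (s'' l))} \<longleftrightarrow>
        s'' \<in> {s''. s'' k = s' k \<and>
          (\<forall>\<tau>\<in>{..<t}. \<forall>l\<in>nbrs G k. bayes_action G \<tau> l s'' = bayes_action G \<tau> l s')}"
        if "s'' \<in> ?supp" for s''
        using Suc.IH[OF that ki] eq by auto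
    qed
    also have "\<dots> = bayes_action G t k s'" by (simp add: bayes_action.simps[of G t])
    finally show ?thesis .
  qed
  have "(\<forall>k\<in>nbrs G j. F (Suc t) k (s' k)) \<longleftrightarrow>
    (\<forall>k\<in>nbrs G j. F t k (s' k)) \<and>
    (\<forall>k\<in>nbrs G j. predict G (F t) k (s' k) = bayes_action G t k s)"
    using FS subi signals_in_support[OF wf Suc.prems(1) ag] by blast
  \<comment> \<open>\<open>pred\<close> holds only under the first conjunct, which stands on both
    sides.\<close>
  also have "\<dots> \<longleftrightarrow> (\<forall>k\<in>nbrs G j. F t k (s' k)) \<and>
    (\<forall>k\<in>nbrs G j. bayes_action G t k s' = bayes_action G t k s)"
    using pred by auto
  also have "\<dots> \<longleftrightarrow> (\<forall>\<tau><Suc t. \<forall>k\<in>nbrs G j. bayes_action G \<tau> k s' = bayes_action G \<tau> k s)"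
    unfolding Suc.IH[OF Suc.prems] by (auto simp: less_Suc_eq)
  finally show ?case .
qed

text \<open>The case \<open>j = i\<close> of the equivalence, allowed by reflexivity: on the
  support, the event given by \<open>F t\<close> and the signal of \<open>i\<close> is her history
  event.\<close>

lemma predict_eq_bayes_action:
  assumes wf: "wf_game G" and tr: "transitive_network G" and i: "i < agents G"
    and F0: "\<And>k z. F 0 k z"
    and FS: "\<And>t k z. k \<in> nbrs G i \<Longrightarrow> z < signals G k \<Longrightarrow>
      F (Suc t) k z \<longleftrightarrow> F t k z \<and> predict G (F t) k z = bayes_action G t k s"
    and s: "s \<in> snd ` set_pmf (joint G)"
  shows "predict G (F t) i (s i) = bayes_action G t i s"
proof -
  have ii: "i \<in> nbrs G i" using tr i by (simp add: transitive_network_def)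
  have prior: "set_pmf (prior G) \<subseteq> {..<states G}" using wf by (simp add: wf_game_def)
  note iff = consistent_iff_same_actions[of G i F s, OF wf tr i F0 FS _ ii, of _ t]
  \<comment> \<open>For the true profile the right-hand side is trivial, so true signals are never
    excluded.\<close>
  have Fs: "\<forall>k\<in>nbrs G i. F t k (s k)" using iff[OF _ _ s] by blast
  have "predict G (F t) i (s i) = optimal_action G i {s'. s' i = s i \<and> (\<forall>k\<in>nbrs G i. F t k (s' k))}"
    using Fs by (intro predict_eq_optimal_action[OF wf i s]) auto
  also have "\<dots> = optimal_action G i {s'. s' i = s i \<and>
      (\<forall>\<tau>\<in>{..<t}. \<forall>k\<in>nbrs G i. bayes_action G \<tau> k s' = bayes_action G \<tau> k s)}"
  proof (rule optimal_action_cong[OF prior])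
    show "{s'. s' i = s i \<and> (\<forall>k\<in>nbrs G i. F t k (s' k))} \<inter> snd ` set_pmf (joint G) \<noteq> {}"
      using Fs s by blast
  qed (use iff in auto)
  finally show ?thesis by (simp add: bayes_action.simps[of G t])
qed

theorem theorem4:
  "\<exists>(c :: com) (C :: nat). \<forall>(G :: game) (i :: nat) (t :: nat) (s :: nat \<Rightarrow> nat).
     wf_game G \<longrightarrow> transitive_network G \<longrightarrow> i < agents G \<longrightarrow> s \<in> snd ` set_pmf (joint G) \<longrightarrow>
       output_at c G i (s i) (\<lambda>\<tau> j. bayes_action G \<tau> j s) t = bayes_action G t i s \<and>
       time_at c G i (s i) (\<lambda>\<tau> j. bayes_action G \<tau> j s) t
         \<le> C * (max_actions G * states G * (agents G)\<^sup>2 * (max_signals G)\<^sup>2)"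
proof (intro exI allI impI)
  fix G i t s
  assume wf: "wf_game G" and tr: "transitive_network G" and i: "i < agents G"
    and s: "s \<in> snd ` set_pmf (joint G)"
  let ?act = "\<lambda>\<tau> j. bayes_action G \<tau> j s"
  let ?in = "store_at bayes_com G i (s i) ?act"
  let ?out = "\<lambda>t. fst (exec bayes_com (?in t))"
  have x: "s i < signals G i" by (rule signals_in_support[OF wf s i])
  have act: "\<forall>j<agents G. 0 < actions G j"
    using wf by (simp add: wf_game_def)
  \<comment> \<open>The cost bounds need all four size parameters positive. A pmf has nonempty
    support, which gives a state; a profile in the support gives a signal.\<close>
  have "set_pmf (prior G) \<noteq> {}" "set_pmf (prior G) \<subseteq> {..<states G}"
    using wf by (auto simp: wf_game_def set_pmf_not_empty)
  then have states: "0 < states G" by fastforce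
  have pos: "0 < max_signals G" "0 < states G" "0 < max_actions G" "0 < agents G"
    using states x signals_le[OF i] act[rule_format, OF i] actions_le[OF i] i by linarith+
  have nbrs: "k < agents G" if "k \<in> nbrs G i" for k
    using wf i that by (auto simp: wf_game_def)
  note e = exec_bayes_com[OF _ act pos i x]
  have inp: "inputs G i (s i) (?in t)" for t
  proof (induction t)
    case 0
    show ?case by (simp add: inputs_def)
  next
    case (Suc t)
    from e(1)[OF Suc] show ?case by (simp add: inputs_def observe_def)
  qed
  \<comment> \<open>The marks after the execution at time \<open>t\<close> reflect the actions at
    times before \<open>t\<close> only.\<close>
  let ?F = "\<lambda>t. consistent (?out t)"
  have F0: "?F 0 k z" for k z
    using e(2)[OF inp[of 0]] by (simp add: consistent_def init_store_def)
  have FS: "?F (Suc t) k z \<longleftrightarrow> ?F t k z \<and> predict G (?F t) k z = bayes_action G t k s"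
    if "k \<in> nbrs G i" "z < signals G k" for t k z
  proof -
    \<comment> \<open>At time \<open>Suc t\<close> the memory holds the predictions for time
      \<open>t\<close> together with the actions of time \<open>t\<close>, which are shown only for
      neighbours of \<open>i\<close>.\<close>
    have "?F (Suc t) k z \<longleftrightarrow> ?F t k z \<and> nats (?out t) ''predicted'' [k, z] = bayes_action G t k s"
      using e(2)[OF inp[of "Suc t"], of k z] that nbrs[OF that(1)]
      by (simp add: consistent_def observe_def)
    then show ?thesis using e(3)[OF inp nbrs[OF that(1)] that(2)] by simp
  qed
  have "output_at bayes_com G i (s i) ?act t = bayes_action G t i s"
    using predict_eq_bayes_action[of G i ?F s, OF wf tr i F0 FS s] e(4)[OF inp[of t]]
    by (simp add: output_at_def)
  moreover have "time_at bayes_com G i (s i) ?act t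
      \<le> 15 * (max_actions G * states G * (agents G)\<^sup>2 * (max_signals G)\<^sup>2)"
    unfolding time_at_def by (rule e(5)[OF inp])
  \<comment> \<open>This fixes the two witnesses: the program \<open>bayes_com\<close> and the
    constant 15, neither depending on the game.\<close>
  ultimately show "output_at bayes_com G i (s i) ?act t = bayes_action G t i s \<and>
      time_at bayes_com G i (s i) ?act t
        \<le> 15 * (max_actions G * states G * (agents G)\<^sup>2 * (max_signals G)\<^sup>2)"
    by blast
qed

end
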